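(* For any $a, b \in \mathbb{N}$, the reflective Ramsey number of the start-central star $S^{\mathrm{sc}}_a$ versus the monotone path $P^{\mathrm{mon}}_b$ satisfies $$R_{\mathrm{ref}}(S^{\mathrm{sc}}_a, P^{\mathrm{mon}}_b) = 1 + (a-1)(b-1).$$
   Context: $\mathbb{N}=\{1,2,3,\ldots\}$. All graphs are undirected, simple and finite, with vertex set $\{0,1,\ldots,n-1\}$ for some $n\in\mathbb{N}$; $|G|$ denotes the order of $G$. $K_n$ is the complete graph on $n$ vertices. A $k$-edge-coloring of a graph is a map from its edge set to $\{1,\ldots,k\}$. For graphs $G,H$ and a permutation group $\Gamma$ on $V(H)$, $H$ is $\Gamma$-embeddable in $G$ if there is a graph homomorphism from $H$ to $G$ of the form $\psi\circ\varphi$, where $\varphi\in\Gamma$ and $\psi\colon V(H)\to V(G)$ is an increasing injection. For graphs $H_1,\ldots,H_k$ and permutation groups $\Gamma_1,\ldots,\Gamma_k$ on their respective vertex sets, the permutational Ramsey number $R(H_1^{\Gamma_1},\ldots,H_k^{\Gamma_k})$ is the minimum $n\in\mathbb{N}$ such that for every $k$-edge-coloring of $K_n$ there is some $j$ for which $H_j$ is $\Gamma_j$-embeddable in the spanning subgraph of $K_n$ comprising the edges of color $j$. The reflective Ramsey number $R_{\mathrm{ref}}(H_1,\ldots,H_k)$ is the permutational Ramsey number in which each $\Gamma_j$ is the group generated by the reflection $x\mapsto |H_j|-1-x$ of $V(H_j)$. For $n\in\mathbb{N}$, the monotone path $P^{\mathrm{mon}}_n$ is the graph of order $n$ in which two vertices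 are adjacent if and only if they are consecutive integers; the start-central star $S^{\mathrm{sc}}_n$ is the star graph of order $n$ in which vertex $0$ is adjacent to all the other vertices (and there are no other edges). *)

theory Defs
  imports "HOL-Algebra.Bij" "HOL-Algebra.Generated_Groups"
begin

text \<open>
  A graph is given by its order \<open>n\<close> and its set of edges, each edge being the set of its two
  ends; its vertex set is \<open>{0, \<dots>, n - 1}\<close>. Records that violate \<open>simple_graph\<close> are junk.
\<close>

record ordered_graph =
  graph_order :: nat
  edges :: "nat set set"

definition verts :: "ordered_graph \<Rightarrow> nat set" where
  "verts G = {..<graph_order G}"

definition simple_graph :: "ordered_graph \<Rightarrow> bool" where
  "simple_graph G \<longleftrightarrow>
     1 \<le> graph_order G \<and> (\<forall>e\<in>edges G. e \<subseteq> verts G \<and> card e = 2)"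

definition complete_graph :: "nat \<Rightarrow> ordered_graph" where
  "complete_graph n =
     \<lparr>graph_order = n, edges = {{u, v} | u v. u < n \<and> v < n \<and> u \<noteq> v}\<rparr>"

definition monotone_path :: "nat \<Rightarrow> ordered_graph" where
  "monotone_path n = \<lparr>graph_order = n, edges = {{i, Suc i} | i. Suc i < n}\<rparr>"

definition start_central_star :: "nat \<Rightarrow> ordered_graph" where
  "start_central_star n = \<lparr>graph_order = n, edges = {{0, i} | i. 0 < i \<and> i < n}\<rparr>"

definition graph_hom :: "ordered_graph \<Rightarrow> ordered_graph \<Rightarrow> (nat \<Rightarrow> nat) \<Rightarrow> bool" where
  "graph_hom H G f \<longleftrightarrow>
     f \<in> verts H \<rightarrow> verts G \<and> (\<forall>u v. {u, v} \<in> edges H \<longrightarrow> {f u, f v} \<in> edges G)"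

text \<open>
  A permutation group on \<open>verts H\<close> is represented by its set of elements, a subgroup of
  \<open>BijGroup (verts H)\<close>; its members are extensional, that is, undefined off \<open>verts H\<close>.
\<close>

definition embeddable ::
    "(nat \<Rightarrow> nat) set \<Rightarrow> ordered_graph \<Rightarrow> ordered_graph \<Rightarrow> bool" where
  "embeddable \<Gamma> H G \<longleftrightarrow>
     (\<exists>\<phi>\<in>\<Gamma>. \<exists>\<psi> \<in> verts H \<rightarrow> verts G.
        strict_mono_on (verts H) \<psi> \<and> graph_hom H G (\<psi> \<circ> \<phi>))"

definition edge_coloring :: "nat \<Rightarrow> ordered_graph \<Rightarrow> (nat set \<Rightarrow> nat) \<Rightarrow> bool" where
  "edge_coloring k G c \<longleftrightarrow> c \<in> edges G \<rightarrow> {1..k}"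

definition color_subgraph ::
    "ordered_graph \<Rightarrow> (nat set \<Rightarrow> nat) \<Rightarrow> nat \<Rightarrow> ordered_graph" where
  "color_subgraph G c j =
     \<lparr>graph_order = graph_order G, edges = {e \<in> edges G. c e = j}\<rparr>"

text \<open>
  The argument lists the pairs \<open>(H\<^sub>1, \<Gamma>\<^sub>1), \<dots>, (H\<^sub>k, \<Gamma>\<^sub>k)\<close>; colors run from 1 but list
  positions from 0.
\<close>

definition permutational_ramsey_number ::
    "(ordered_graph \<times> (nat \<Rightarrow> nat) set) list \<Rightarrow> nat" where
  "permutational_ramsey_number Hs =
     (LEAST n. 1 \<le> n \<and>
        (\<forall>c. edge_coloring (length Hs) (complete_graph n) c \<longrightarrow>
           (\<exists>j\<in>{1..length Hs}.
              embeddable (snd (Hs ! (j - 1))) (fst (Hs ! (j - 1)))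
                (color_subgraph (complete_graph n) c j))))"

definition reflection :: "ordered_graph \<Rightarrow> nat \<Rightarrow> nat" where
  "reflection H = (\<lambda>x\<in>verts H. graph_order H - 1 - x)"

definition reflection_group :: "ordered_graph \<Rightarrow> (nat \<Rightarrow> nat) set" where
  "reflection_group H = generate (BijGroup (verts H)) {reflection H}"

definition reflective_ramsey_number :: "ordered_graph list \<Rightarrow> nat" where
  "reflective_ramsey_number Hs =
     permutational_ramsey_number (map (\<lambda>H. (H, reflection_group H)) Hs)"

lemma simple_graph_complete_graph: "1 \<le> n \<Longrightarrow> simple_graph (complete_graph n)"
  by (auto simp: simple_graph_def complete_graph_def verts_def card_2_iff)

lemma simple_graph_monotone_path: "1 \<le> n \<Longrightarrow> simple_graph (monotone_path n)"
  by (auto simp: simple_graph_def monotone_path_def verts_def)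

lemma simple_graph_start_central_star: "1 \<le> n \<Longrightarrow> simple_graph (start_central_star n)"
  by (auto simp: simple_graph_def start_central_star_def verts_def)

lemma simple_graph_color_subgraph: "simple_graph G \<Longrightarrow> simple_graph (color_subgraph G c j)"
  by (auto simp: simple_graph_def color_subgraph_def verts_def)

lemma reflection_in_BijGroup: "reflection H \<in> carrier (BijGroup (verts H))"
proof -
  have "bij_betw (reflection H) (verts H) (verts H)"
    by (rule bij_betw_byWitness[where f' = "reflection H"])
       (auto simp: reflection_def verts_def)
  then show ?thesis
    by (simp add: BijGroup_def Bij_def reflection_def)
qed

lemma subgroup_reflection_group: "subgroup (reflection_group H) (BijGroup (verts H))"
  unfolding reflection_group_def
  by (rule group.generate_is_subgroup[OF group_BijGroup]) (simp add: reflection_in_BijGroup)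

end

theory Submission
  imports Defs
begin

text \<open>
  Write \<open>m = a - 1\<close> and \<open>k = b - 1\<close>, and call the edges of color 1 red and those of color 2 blue.

  For the upper bound, embed by the identity permutation. Orienting the blue edges upwards gives an
  acyclic digraph, which, as in Mirsky's and the Gallai-Roy theorem, splits into as many independent sets as
  its longest path has vertices. So among more than \<open>m * k\<close> vertices there is either a blue
  monotone path with \<open>k + 1\<close> vertices or a set of more than \<open>m\<close> vertices with no blue edge inside
  (\<open>independent_set_or_monotone_path\<close>). Such a set is a red clique, and any ordering of \<open>a\<close> of its
  vertices gives a red star, in particular the start-central one.

  For the lower bound, cut the vertices \<open>0, \<dots>, m * k - 1\<close> into \<open>k\<close> intervals of length \<open>m\<close>, color
  edges inside an interval red and edges between different intervals blue. A red star, wherever its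
  center is, stays within one interval and so has at most \<open>m\<close> vertices. A blue monotone path enters
  a later interval at every step and so has at most \<open>k\<close> vertices. Reflecting the path changes
  nothing, because the reflection is an automorphism of the monotone path
  (\<open>monotone_path_hom_reflect\<close>).
\<close>

section \<open>Embeddings up to reflection\<close>

text \<open>The reflection is an involution, so it generates a group with at most two elements.\<close>

lemma reflection_group_cases:
  assumes "\<phi> \<in> reflection_group H"
  obtains "\<phi> = (\<lambda>x\<in>verts H. x)" | "\<phi> = reflection H"
proof -
  let ?B = "BijGroup (verts H)"
  interpret group ?B by (rule group_BijGroup)
  have one: "\<one>\<^bsub>?B\<^esub> = (\<lambda>x\<in>verts H. x)"
    by (simp add: BijGroup_def)
  have r: "reflection H \<in> carrier ?B"
    by (rule reflection_in_BijGroup)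
  have rr: "reflection H \<otimes>\<^bsub>?B\<^esub> reflection H = \<one>\<^bsub>?B\<^esub>"
    using r by (auto simp: BijGroup_def compose_def reflection_def verts_def fun_eq_iff)
  have inv_r: "inv\<^bsub>?B\<^esub> (reflection H) = reflection H"
    using rr r r by (rule inv_equality)
  from assms have "\<phi> = \<one>\<^bsub>?B\<^esub> \<or> \<phi> = reflection H"
    unfolding reflection_group_def
  proof (induction rule: generate.induct)
    case (eng g h)
    then show ?case using r rr by auto
  qed (auto simp: inv_r)
  then show thesis using that one by auto
qed

lemma reflection_group_bij:
  assumes "\<phi> \<in> reflection_group H"
  shows "bij_betw \<phi> (verts H) (verts H)"
  using subgroup.subset[OF subgroup_reflection_group, of H] assms
  by (auto simp: BijGroup_def Bij_def)

text \<open>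
  The reflection group contains the identity, so ordinary monotone embeddings count. Simplicity
  of \<open>H\<close> ensures that the extensional identity is only evaluated at vertices.
\<close>

lemma embeddable_reflection_groupI:
  assumes "simple_graph H" "strict_mono_on (verts H) \<psi>" "graph_hom H G \<psi>"
  shows "embeddable (reflection_group H) H G"
proof -
  have id: "(\<lambda>x\<in>verts H. x) \<in> reflection_group H"
    using subgroup.one_closed[OF subgroup_reflection_group, of H] by (simp add: BijGroup_def)
  have "u \<in> verts H \<and> v \<in> verts H" if "{u, v} \<in> edges H" for u v
    using assms(1) that by (auto simp: simple_graph_def)
  then have "graph_hom H G (\<psi> \<circ> (\<lambda>x\<in>verts H. x))"
    using assms(3) by (auto simp: graph_hom_def)
  moreover have "\<psi> \<in> verts H \<rightarrow> verts G"
    using assms(3) by (simp add: graph_hom_def)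
  ultimately show ?thesis
    using assms(2) id by (auto simp: embeddable_def)
qed

text \<open>
  Forgetting the order leaves an injective homomorphism. For the star this suffices, since the
  obstruction to a red star is a bound on the number of its vertices.
\<close>

lemma embeddable_reflection_groupE_inj:
  assumes "embeddable (reflection_group H) H G"
  obtains f where "inj_on f (verts H)" "graph_hom H G f"
proof -
  from assms obtain \<phi> \<psi> where \<phi>: "\<phi> \<in> reflection_group H"
    and \<psi>: "strict_mono_on (verts H) \<psi>" and hom: "graph_hom H G (\<psi> \<circ> \<phi>)"
    by (auto simp: embeddable_def)
  have "inj_on (\<psi> \<circ> \<phi>) (verts H)"
    using reflection_group_bij[OF \<phi>] strict_mono_on_imp_inj_on[OF \<psi>]
    by (auto simp: bij_betw_def intro: comp_inj_on)
  then show thesis using that hom by blast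
qed

lemma graph_hom_monotone_path_iff:
  "graph_hom (monotone_path b) G f \<longleftrightarrow>
     f \<in> {..<b} \<rightarrow> verts G \<and> (\<forall>i. Suc i < b \<longrightarrow> {f i, f (Suc i)} \<in> edges G)"
  by (auto simp: graph_hom_def monotone_path_def verts_def doubleton_eq_iff insert_commute)

lemma graph_hom_start_central_star_iff:
  "graph_hom (start_central_star a) G f \<longleftrightarrow>
     f \<in> {..<a} \<rightarrow> verts G \<and> (\<forall>i. 0 < i \<and> i < a \<longrightarrow> {f 0, f i} \<in> edges G)"
  by (auto simp: graph_hom_def start_central_star_def verts_def doubleton_eq_iff insert_commute)

text \<open>The reflection maps the edge \<open>{i, i + 1}\<close> of the path to the edge \<open>{b - 2 - i, b - 1 - i}\<close>.\<close>

lemma monotone_path_hom_reflect: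
  assumes "\<psi> \<in> {..<b} \<rightarrow> verts G"
    and "graph_hom (monotone_path b) G (\<psi> \<circ> reflection (monotone_path b))"
  shows "graph_hom (monotone_path b) G \<psi>"
  unfolding graph_hom_monotone_path_iff
proof (intro conjI allI impI)
  fix i assume i: "Suc i < b"
  define j where "j = b - 2 - i"
  have j: "Suc j < b" "b - 1 - j = Suc i" "b - 1 - Suc j = i"
    using i by (auto simp: j_def)
  have "{\<psi> (b - 1 - j), \<psi> (b - 1 - Suc j)} \<in> edges G"
    using assms(2) j(1) unfolding graph_hom_monotone_path_iff
    by (auto simp: reflection_def verts_def monotone_path_def)
  then show "{\<psi> i, \<psi> (Suc i)} \<in> edges G"
    unfolding j by (simp add: insert_commute)
qed (rule assms(1))

lemma embeddable_monotone_pathE: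
  assumes "embeddable (reflection_group (monotone_path b)) (monotone_path b) G"
  obtains \<psi> where "strict_mono_on {..<b} \<psi>" "graph_hom (monotone_path b) G \<psi>"
proof -
  have V: "verts (monotone_path b) = {..<b}"
    by (simp add: verts_def monotone_path_def)
  from assms obtain \<phi> \<psi> where \<phi>: "\<phi> \<in> reflection_group (monotone_path b)"
    and \<psi>: "\<psi> \<in> {..<b} \<rightarrow> verts G" "strict_mono_on {..<b} \<psi>"
    and hom: "graph_hom (monotone_path b) G (\<psi> \<circ> \<phi>)"
    by (auto simp: embeddable_def V)
  from \<phi> have "graph_hom (monotone_path b) G \<psi>"
  proof (cases rule: reflection_group_cases)
    case 1
    with hom \<psi>(1) show ?thesis
      by (auto simp: graph_hom_monotone_path_iff V)
  next
    case 2
    with hom \<psi>(1) show ?thesis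
      by (auto intro: monotone_path_hom_reflect)
  qed
  with \<psi>(2) show thesis by (rule that)
qed

section \<open>Independent sets and monotone paths\<close>

text \<open>
  By induction on \<open>k\<close>: the elements of \<open>V\<close> that have no smaller \<open>E\<close>-neighbor in \<open>V\<close> are independent. If
  there are at most \<open>m\<close> of them, a path with \<open>k\<close> edges exists among the remaining elements, and its
  first element has a smaller neighbor in \<open>V\<close> by which the path can be extended.
\<close>

lemma independent_set_or_monotone_path:
  fixes V :: "'a::linorder set" and E :: "'a \<Rightarrow> 'a \<Rightarrow> bool"
  assumes "finite V" "m * k < card V"
  shows "(\<exists>C\<subseteq>V. m < card C \<and> (\<forall>x\<in>C. \<forall>y\<in>C. x < y \<longrightarrow> \<not> E x y)) \<or>
         (\<exists>p. p ` {..k} \<subseteq> V \<and> strict_mono_on {..k} p \<and> (\<forall>i<k. E (p i) (p (Suc i))))"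
  using assms
proof (induction k arbitrary: V)
  case 0
  then obtain v where "v \<in> V" by fastforce
  then have "(\<lambda>_. v) ` {..0} \<subseteq> V \<and> strict_mono_on {..0::nat} (\<lambda>_. v)"
    by (auto simp: strict_mono_on_def)
  then show ?case by (intro disjI2 exI[of _ "\<lambda>_. v"]) auto
next
  case (Suc k)
  define S where "S = {v\<in>V. \<forall>u\<in>V. u < v \<longrightarrow> \<not> E u v}"
  show ?case
  proof (cases "m < card S")
    case True
    then show ?thesis
      by (intro disjI1 exI[of _ S]) (auto simp: S_def)
  next
    case False
    have "S \<subseteq> V" by (auto simp: S_def)
    then have "card (V - S) = card V - card S"
      using Suc.prems(1) by (meson card_Diff_subset finite_subset)
    then have "m * k < card (V - S)"
      using False Suc.prems(2) by simp
    from Suc.IH[OF _ this] Suc.prems(1) consider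
      C where "C \<subseteq> V - S" "m < card C" "\<forall>x\<in>C. \<forall>y\<in>C. x < y \<longrightarrow> \<not> E x y"
      | p where "p ` {..k} \<subseteq> V - S" "strict_mono_on {..k} p" "\<forall>i<k. E (p i) (p (Suc i))"
      by auto
    then show ?thesis
    proof cases
      case 1
      then show ?thesis by blast
    next
      case 2
      have "p 0 \<in> V - S" using 2(1) by auto
      then obtain u where u: "u \<in> V" "u < p 0" "E u (p 0)"
        by (auto simp: S_def)
      define q where "q = case_nat u p"
      have below: "u < p i" if "i \<le> k" for i
        using u(2) that strict_mono_onD[OF 2(2), of 0 i] by (cases "i = 0") auto
      have "q i \<in> V" if "i \<le> Suc k" for i
        using that u(1) 2(1) by (cases i) (auto simp: q_def)
      moreover have "strict_mono_on {..Suc k} q"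
      proof (rule strict_mono_onI)
        fix i j assume ij: "i \<in> {..Suc k}" "j \<in> {..Suc k}" "i < j"
        then obtain j' where j': "j = Suc j'" by (cases j) auto
        show "q i < q j"
        proof (cases i)
          case 0
          then show ?thesis using below ij j' by (simp add: q_def)
        next
          case (Suc i')
          then show ?thesis using strict_mono_onD[OF 2(2), of i' j'] ij j' by (simp add: q_def)
        qed
      qed
      moreover have "E (q i) (q (Suc i))" if "i < Suc k" for i
        using that u(3) 2(3) by (cases i) (auto simp: q_def)
      ultimately show ?thesis
        by (intro disjI2 exI[of _ q]) auto
    qed
  qed
qed

lemma ex_strict_mono_on_into:
  fixes C :: "'a::linorder set"
  assumes "finite C" "a \<le> card C"
  obtains \<psi> where "strict_mono_on {..<a} \<psi>" "\<psi> ` {..<a} \<subseteq> C"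
proof
  let ?\<psi> = "(!) (sorted_list_of_set C)"
  show "strict_mono_on {..<a} ?\<psi>"
  proof (rule strict_mono_onI)
    fix i j assume "i \<in> {..<a}" "j \<in> {..<a}" "i < j"
    with assms(2) have "j < length (sorted_list_of_set C)" by simp
    with strict_sorted_list_of_set \<open>i < j\<close> show "?\<psi> i < ?\<psi> j"
      by (rule sorted_wrt_nth_less)
  qed
  show "?\<psi> ` {..<a} \<subseteq> C"
  proof
    fix x assume "x \<in> ?\<psi> ` {..<a}"
    then obtain i where "i < a" "x = ?\<psi> i" by blast
    with assms(2) have "x \<in> set (sorted_list_of_set C)" by simp
    with assms(1) show "x \<in> C" by simp
  qed
qed

section \<open>The two bounds\<close>

lemma edges_color_subgraph_complete:
  "{u, v} \<in> edges (color_subgraph (complete_graph n) c j) \<longleftrightarrow>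
     u < n \<and> v < n \<and> u \<noteq> v \<and> c {u, v} = j"
  by (auto simp: color_subgraph_def complete_graph_def doubleton_eq_iff)

lemma verts_color_subgraph_complete:
  "verts (color_subgraph (complete_graph n) c j) = {..<n}"
  by (simp add: verts_def color_subgraph_def complete_graph_def)

lemma star_or_path_embeddable:
  assumes "1 \<le> a" "1 \<le> b" "(a - 1) * (b - 1) < n"
    and c: "edge_coloring 2 (complete_graph n) c"
  shows "embeddable (reflection_group (start_central_star a)) (start_central_star a)
           (color_subgraph (complete_graph n) c 1) \<or>
         embeddable (reflection_group (monotone_path b)) (monotone_path b)
           (color_subgraph (complete_graph n) c 2)"
proof -
  have "(a - 1) * (b - 1) < card {..<n}" using assms(3) by simp
  from independent_set_or_monotone_path[OF _ this, of "\<lambda>u v. c {u, v} = 2"] consider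
    C where "C \<subseteq> {..<n}" "a - 1 < card C" "\<forall>x\<in>C. \<forall>y\<in>C. x < y \<longrightarrow> c {x, y} \<noteq> 2"
    | p where "p ` {..b - 1} \<subseteq> {..<n}" "strict_mono_on {..b - 1} p"
        "\<forall>i<b - 1. c {p i, p (Suc i)} = 2"
    by auto
  then show ?thesis
  proof cases
    case 1
    have "finite C" using 1(1) finite_subset by blast
    moreover have "a \<le> card C" using 1(2) by simp
    ultimately obtain \<psi> where \<psi>: "strict_mono_on {..<a} \<psi>" "\<psi> ` {..<a} \<subseteq> C"
      by (rule ex_strict_mono_on_into)
    have \<psi>_less: "\<psi> i < n" if "i < a" for i
      using that \<psi>(2) 1(1) by auto
    have red: "\<psi> 0 \<noteq> \<psi> i \<and> c {\<psi> 0, \<psi> i} = 1" if i: "0 < i" "i < a" for i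
    proof -
      have less: "\<psi> 0 < \<psi> i" using strict_mono_onD[OF \<psi>(1), of 0 i] i by simp
      have "{\<psi> 0, \<psi> i} \<in> edges (complete_graph n)"
        unfolding complete_graph_def using less \<psi>_less[of i] i
        by (simp, intro exI[of _ "\<psi> 0"] exI[of _ "\<psi> i"]) simp
      then have "c {\<psi> 0, \<psi> i} \<in> {1..2}"
        using c by (auto simp: edge_coloring_def)
      moreover have "c {\<psi> 0, \<psi> i} \<noteq> 2"
        using 1(3) less \<psi>(2) i by (simp add: image_subset_iff)
      ultimately show ?thesis using less by auto
    qed
    have "graph_hom (start_central_star a) (color_subgraph (complete_graph n) c 1) \<psi>"
      using red \<psi>_less assms(1)
      by (auto simp: graph_hom_start_central_star_iff edges_color_subgraph_complete
          verts_color_subgraph_complete)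
    moreover have "verts (start_central_star a) = {..<a}"
      by (simp add: verts_def start_central_star_def)
    ultimately show ?thesis
      using \<psi>(1) assms(1)
      by (intro disjI1 embeddable_reflection_groupI simple_graph_start_central_star) auto
  next
    case 2
    have eq: "{..b - 1} = {..<b}" using assms(2) by auto
    have less: "p i < n" if "i < b" for i
      using that 2(1) eq by auto
    have blue: "p i \<noteq> p (Suc i) \<and> c {p i, p (Suc i)} = 2" if "Suc i < b" for i
      using that 2(3) strict_mono_onD[OF 2(2)[unfolded eq], of i "Suc i"] by simp
    have "graph_hom (monotone_path b) (color_subgraph (complete_graph n) c 2) p"
      using blue less
      by (auto simp: graph_hom_monotone_path_iff edges_color_subgraph_complete
          verts_color_subgraph_complete)
    moreover have "verts (monotone_path b) = {..<b}"
      by (simp add: verts_def monotone_path_def)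
    ultimately show ?thesis
      using 2(2) assms(2) eq
      by (intro disjI2 embeddable_reflection_groupI simple_graph_monotone_path) auto
  qed
qed

text \<open>
  Edges within a block \<open>{q * m, \<dots>, q * m + m - 1}\<close> get color 1. The condition is phrased for a set
  of vertices because colorings act on edges as sets, without a choice of a first end.
\<close>

definition block_coloring :: "nat \<Rightarrow> nat set \<Rightarrow> nat" where
  "block_coloring m e = (if \<exists>q. \<forall>x\<in>e. x div m = q then 1 else 2)"

lemma block_coloring_pair:
  "block_coloring m {u, v} = (if u div m = v div m then 1 else 2)"
  by (auto simp: block_coloring_def)

text \<open>All vertices of a red star lie in the block of its center, which is too small for them.\<close>

lemma star_not_embeddable_block_coloring:
  assumes "0 < m" "m < a"
  shows "\<not> embeddable (reflection_group (start_central_star a)) (start_central_star a)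
           (color_subgraph (complete_graph n) (block_coloring m) 1)"
proof
  assume "embeddable (reflection_group (start_central_star a)) (start_central_star a)
    (color_subgraph (complete_graph n) (block_coloring m) 1)"
  then obtain f where inj: "inj_on f (verts (start_central_star a))"
    and hom: "graph_hom (start_central_star a)
      (color_subgraph (complete_graph n) (block_coloring m) 1) f"
    by (rule embeddable_reflection_groupE_inj)
  define q where "q = f 0 div m"
  have block: "f i div m = q" if "i < a" for i
    using hom that
    by (cases "i = 0")
       (auto simp: q_def graph_hom_start_central_star_iff edges_color_subgraph_complete
         block_coloring_pair split: if_splits)
  have "f i \<in> {q * m..<q * m + m}" if "i < a" for i
    using div_times_less_eq_dividend[of "f i" m] dividend_less_div_times[OF assms(1), of "f i"]
    unfolding block[OF that] atLeastLessThan_iff by (metis add.commute)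
  then have "f ` {..<a} \<subseteq> {q * m..<q * m + m}" by auto
  then have "card (f ` {..<a}) \<le> m"
    using card_mono[of "{q * m..<q * m + m}"] by simp
  moreover have "card (f ` {..<a}) = a"
    using inj by (simp add: card_image verts_def start_central_star_def)
  ultimately show False using assms(2) by simp
qed

text \<open>
  Each step of a blue monotone path raises the block number, so its last vertex would have block
  number at least \<open>b - 1\<close>, while the blocks that meet \<open>{0, \<dots>, n - 1}\<close> have smaller numbers.
\<close>

lemma path_not_embeddable_block_coloring:
  assumes "1 \<le> b" "n \<le> (b - 1) * m"
  shows "\<not> embeddable (reflection_group (monotone_path b)) (monotone_path b)
           (color_subgraph (complete_graph n) (block_coloring m) 2)"
proof
  assume "embeddable (reflection_group (monotone_path b)) (monotone_path b)
    (color_subgraph (complete_graph n) (block_coloring m) 2)"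
  then obtain \<psi> where mono: "strict_mono_on {..<b} \<psi>"
    and hom: "graph_hom (monotone_path b)
      (color_subgraph (complete_graph n) (block_coloring m) 2) \<psi>"
    by (rule embeddable_monotone_pathE)
  have block: "i \<le> \<psi> i div m" if "i < b" for i
    using that
  proof (induction i)
    case (Suc i)
    have "\<psi> i div m \<noteq> \<psi> (Suc i) div m"
      using hom Suc.prems
      by (auto simp: graph_hom_monotone_path_iff edges_color_subgraph_complete
          block_coloring_pair)
    moreover have "\<psi> i div m \<le> \<psi> (Suc i) div m"
      using strict_mono_onD[OF mono, of i "Suc i"] Suc.prems by (simp add: div_le_mono)
    ultimately show ?case using Suc by simp
  qed simp
  have "\<psi> (b - 1) < n"
    using hom assms(1)
    by (auto simp: graph_hom_monotone_path_iff verts_color_subgraph_complete)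
  then have "\<psi> (b - 1) div m < b - 1"
    using assms(2) by (intro less_mult_imp_div_less) simp
  with block[of "b - 1"] assms(1) show False by simp
qed

theorem corollary4p3:
  fixes a b :: nat
  assumes "1 \<le> a" and "1 \<le> b"
  shows "reflective_ramsey_number [start_central_star a, monotone_path b]
           = 1 + (a - 1) * (b - 1)"
proof -
  let ?emb = "\<lambda>n c H j. embeddable (reflection_group H) H (color_subgraph (complete_graph n) c j)"
  let ?P = "\<lambda>n. 1 \<le> n \<and> (\<forall>c. edge_coloring 2 (complete_graph n) c \<longrightarrow>
    ?emb n c (start_central_star a) 1 \<or> ?emb n c (monotone_path b) 2)"
  have colors: "{1..2} = {1, 2::nat}" by auto
  have "reflective_ramsey_number [start_central_star a, monotone_path b] = (LEAST n. ?P n)"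
    by (simp add: reflective_ramsey_number_def permutational_ramsey_number_def
        numeral_2_eq_2[symmetric] colors del: One_nat_def)
  also have "\<dots> = 1 + (a - 1) * (b - 1)"
  proof (rule Least_equality)
    show "?P (1 + (a - 1) * (b - 1))"
      using star_or_path_embeddable[OF assms] by simp
  next
    fix n assume n: "?P n"
    show "1 + (a - 1) * (b - 1) \<le> n"
    proof (rule ccontr)
      assume "\<not> 1 + (a - 1) * (b - 1) \<le> n"
      then have le: "n \<le> (b - 1) * (a - 1)" by (simp add: mult.commute)
      \<comment> \<open>If \<open>a = 1\<close> there is nothing to color, as \<open>n\<close> would have to be 0.\<close>
      with n have pos: "0 < a - 1" by (cases "a - 1 = 0") auto
      have "edge_coloring 2 (complete_graph n) (block_coloring (a - 1))"
        by (auto simp: edge_coloring_def block_coloring_def)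
      with n star_not_embeddable_block_coloring[of "a - 1" a n] pos
        path_not_embeddable_block_coloring[OF assms(2) le]
      show False by auto
    qed
  qed
  finally show ?thesis .
qed

end
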